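(* Let $\widetilde K:\mathbb R\times\mathbb R\to\mathbb R$ be a continuous real covariance (symmetric positive semidefinite) kernel which is stationary and normalized: $\widetilde K(x+a,y+a)=\widetilde K(x,y)$ for all $x,y,a\in\mathbb R$ and $\widetilde K(x,x)=1$. Assume that its stationary profile $\kappa(t)=\widetilde K(t,0)$ is $C^2$ at zero with $\kappa''(0)<0$, and that for some integer $n_0\ge2$ and some real number $a>1$, $$\widetilde K(ax,ay)=\widetilde K(x,y)^{n_0}\qquad(x,y\in\mathbb R).$$ Then $a=\sqrt{n_0}$ and $$\widetilde K(x,y)=e^{-c(x-y)^2}\quad(x,y\in\mathbb R),\qquad c=-\tfrac12\kappa''(0)>0.$$ In particular, rescaling the parameter line reduces the kernel to $e^{-(x-y)^2}$, and the normalization $-\kappa''(0)=2$ gives $\widetilde K(x,y)=e^{-(x-y)^2}$ exactly. *)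

theory Defs
  imports "HOL-Analysis.Analysis"
begin

definition covariance_kernel :: "('a \<Rightarrow> 'a \<Rightarrow> real) \<Rightarrow> bool" where
  "covariance_kernel K \<longleftrightarrow>
     (\<forall>x y. K x y = K y x) \<and>
     (\<forall>(n::nat) (x::nat \<Rightarrow> 'a) (u::nat \<Rightarrow> real).
        0 \<le> (\<Sum>i<n. \<Sum>j<n. u i * u j * K (x i) (x j)))"

definition stationary_kernel :: "(real \<Rightarrow> real \<Rightarrow> real) \<Rightarrow> bool" where
  "stationary_kernel K \<longleftrightarrow> (\<forall>x y a. K (x + a) (y + a) = K x y)"

definition normalized_kernel :: "('a \<Rightarrow> 'a \<Rightarrow> real) \<Rightarrow> bool" where
  "normalized_kernel K \<longleftrightarrow> (\<forall>x. K x x = 1)"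

definition stationary_profile :: "(real \<Rightarrow> real \<Rightarrow> real) \<Rightarrow> real \<Rightarrow> real" where
  "stationary_profile K t = K t 0"

text \<open>
  Being $C^2$ at a point is read pointwise: the second derivative exists in some neighbourhood of
  the point but is only required to be continuous at the point itself, which is weaker than being
  $C^2$ on a neighbourhood. The differentiability conditions are needed because
  \<^term>\<open>deriv\<close> is a total operator.
\<close>

definition C2_at :: "(real \<Rightarrow> real) \<Rightarrow> real \<Rightarrow> bool" where
  "C2_at f x \<longleftrightarrow>
     (\<forall>\<^sub>F t in nhds x. f differentiable (at t)) \<and>
     (\<forall>\<^sub>F t in nhds x. deriv f differentiable (at t)) \<and>
     isCont (deriv (deriv f)) x"

end

theory Submission
  imports Defs
begin

text \<open>
  The quotient \<open>q t = ln (\<kappa> t) / t\<^sup>2\<close> tends to \<open>\<kappa>''(0) / 2\<close> at the origin, since \<open>\<kappa>\<close> is even with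
  \<open>\<kappa> 0 = 1\<close>. The scaling equation becomes \<open>q (a t) = (n\<^sub>0 / a\<^sup>2) q t\<close>; letting \<open>t\<close> tend to \<open>0\<close> and using
  that the limit is nonzero gives \<open>a\<^sup>2 = n\<^sub>0\<close>. So \<open>q\<close> is invariant under \<open>t \<mapsto> t / a\<close>, and iterating
  shows that \<open>q\<close> equals its limit at the origin everywhere.
\<close>

lemma deriv_even_at_zero:
  fixes f :: "real \<Rightarrow> real"
  assumes "f differentiable (at 0)" and even: "\<And>t. f (- t) = f t"
  shows "deriv f 0 = 0"
proof -
  have D: "(f has_field_derivative deriv f 0) (at 0)"
    using assms(1) DERIV_deriv_iff_real_differentiable by blast
  have "((\<lambda>t. f (- t)) has_field_derivative - deriv f 0) (at 0)"
    using DERIV_mirror[of f "deriv f 0" 0] D by simp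
  then show ?thesis
    using D DERIV_unique[of f "deriv f 0" 0 "- deriv f 0"] even by simp
qed

text \<open>One use of l'Hopital's rule suffices: the quotient of derivatives is
  \<open>(deriv f t / t) / (2 * f t)\<close>, whose first factor already converges by
  differentiability of \<open>deriv f\<close> at 0.\<close>

lemma tendsto_ln_over_square:
  fixes f :: "real \<Rightarrow> real"
  assumes C2: "C2_at f 0" and f0: "f 0 = 1" and f'0: "deriv f 0 = 0"
  shows "((\<lambda>t. ln (f t) / t\<^sup>2) \<longlongrightarrow> deriv (deriv f) 0 / 2) (at 0)"
proof -
  have ev: "\<forall>\<^sub>F t in nhds 0. (f has_field_derivative deriv f t) (at t)"
    using C2 by (simp add: C2_at_def DERIV_deriv_iff_real_differentiable)
  have "deriv f differentiable (at 0)"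
    using C2 eventually_nhds_x_imp_x by (auto simp: C2_at_def)
  then have D2: "(deriv f has_field_derivative deriv (deriv f) 0) (at 0)"
    using DERIV_deriv_iff_real_differentiable by blast
  have "isCont f 0"
    using eventually_nhds_x_imp_x[OF ev] DERIV_isCont by blast
  then have lim1: "(f \<longlongrightarrow> 1) (at 0)"
    using f0 by (simp add: isCont_def)
  then have pos: "\<forall>\<^sub>F t in at 0. f t > 0"
    by (rule order_tendstoD(1)) simp
  \<comment> \<open>As \<open>deriv f 0 = 0\<close>, this is the difference quotient of
    \<open>deriv f\<close> at 0.\<close>
  have "((\<lambda>t. deriv f t / t) \<longlongrightarrow> deriv (deriv f) 0) (at 0)"
    using D2 f'0 by (simp add: has_field_derivative_iff)
  then have "((\<lambda>t. (deriv f t / t) / (2 * f t)) \<longlongrightarrow> deriv (deriv f) 0 / (2 * 1)) (at 0)"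
    by (intro tendsto_intros lim1) auto
  then have quot: "((\<lambda>t. (deriv f t / f t) / (2 * t)) \<longlongrightarrow> deriv (deriv f) 0 / 2) (at 0)"
    by (simp add: mult_ac)
  show ?thesis
  proof (rule lhopital[OF _ _ _ _ _ _ quot])
    show "((\<lambda>t. ln (f t)) \<longlongrightarrow> 0) (at 0)"
      using tendsto_ln[OF lim1] by simp
    show "((\<lambda>t. t\<^sup>2) \<longlongrightarrow> (0::real)) (at 0)"
      using tendsto_power[OF tendsto_ident_at[of "0::real" UNIV], of 2] by simp
    show "\<forall>\<^sub>F t in at 0. t\<^sup>2 \<noteq> (0::real)" "\<forall>\<^sub>F t in at 0. 2 * t \<noteq> (0::real)"
      by (simp_all add: eventually_at_filter)
    show "\<forall>\<^sub>F t in at 0. ((\<lambda>t. ln (f t)) has_real_derivative deriv f t / f t) (at t)"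
      using pos eventually_nhds_conv_at[THEN iffD1, OF ev, THEN conjunct1]
      by eventually_elim (auto intro!: derivative_eq_intros)
    show "\<forall>\<^sub>F t in at 0. ((\<lambda>t. t\<^sup>2) has_real_derivative 2 * t) (at t)"
      by (intro always_eventually allI) (auto intro!: derivative_eq_intros)
  qed
qed

text \<open>The target is the punctured filter \<open>at 0\<close>, so limits and eventual
  properties at the origin, which ignore the value there, transfer to this sequence.\<close>

lemma filterlim_div_power_at_zero:
  fixes a t :: real
  assumes "a > 1" and "t \<noteq> 0"
  shows "filterlim (\<lambda>m. t / a ^ m) (at 0) sequentially"
  unfolding filterlim_at
proof
  show "\<forall>\<^sub>F m in sequentially. t / a ^ m \<in> UNIV \<and> t / a ^ m \<noteq> 0"
    using assms by simp
  have "(\<lambda>m. inverse a ^ m) \<longlonglongrightarrow> 0"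
    using assms(1) by (intro LIMSEQ_power_zero) (simp add: inverse_less_1_iff)
  from tendsto_mult_right_zero[OF this, of t] show "(\<lambda>m. t / a ^ m) \<longlonglongrightarrow> 0"
    by (simp add: divide_inverse power_inverse)
qed

text \<open>Positivity spreads outward from the origin: some \<open>t / a ^ m\<close> lies in the
  region where \<open>f\<close> is positive, and each multiplication by \<open>a\<close> only raises
  the value to a power.\<close>

lemma power_scaling_pos:
  fixes f :: "real \<Rightarrow> real"
  assumes a: "a > 1" and scale: "\<And>t. f (a * t) = f t ^ n"
    and pos: "\<forall>\<^sub>F t in at 0. f t > 0" and "t \<noteq> 0"
  shows "f t > 0"
proof -
  \<comment> \<open>The point \<open>s\<close> stays arbitrary because the induction hypothesis is
    applied at \<open>s / a\<close>.\<close>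
  have *: "f (s / a ^ m) > 0 \<Longrightarrow> f s > 0" for s m
  proof (induction m arbitrary: s)
    case (Suc m)
    then have "f (s / a) > 0"
      by simp
    then show ?case
      using scale[of "s / a"] a by simp
  qed simp
  have "\<forall>\<^sub>F m in sequentially. f (t / a ^ m) > 0"
    using filterlim_div_power_at_zero[OF a \<open>t \<noteq> 0\<close>] pos by (auto simp: filterlim_iff)
  then show ?thesis
    using * eventually_happens'[OF sequentially_bot] by blast
qed

text \<open>Along \<open>t / a ^ m\<close> the function is constant, yet it tends to
  \<open>l\<close>; limits in a Hausdorff space are unique.\<close>

lemma scaling_invariant_eq_limit:
  fixes q :: "real \<Rightarrow> 'b::t2_space"
  assumes a: "a > 1" and scale: "\<And>t. t \<noteq> 0 \<Longrightarrow> q (a * t) = q t"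
    and lim: "(q \<longlongrightarrow> l) (at 0)" and t: "t \<noteq> 0"
  shows "q t = l"
proof -
  have "q (t / a ^ m) = q t" for m
  proof (induction m)
    case (Suc m)
    then show ?case
      using scale[of "t / a ^ Suc m"] a t by simp
  qed simp
  then have "(\<lambda>m. q t) \<longlonglongrightarrow> l"
    using filterlim_compose[OF lim filterlim_div_power_at_zero[OF a t]] by simp
  then show ?thesis
    by (simp add: LIMSEQ_const_iff)
qed

text \<open>Along \<open>1 / a ^ m\<close> each value is \<open>r\<close> times the next one, so
  passing to the limit on both sides gives \<open>l = r * l\<close>.\<close>

lemma scaling_factor_eq_one:
  fixes q :: "real \<Rightarrow> real"
  assumes a: "a > 1" and scale: "\<And>t. t \<noteq> 0 \<Longrightarrow> q (a * t) = r * q t"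
    and lim: "(q \<longlongrightarrow> l) (at 0)" and l: "l \<noteq> 0"
  shows "r = 1"
proof -
  note z = filterlim_div_power_at_zero[OF a, of 1, simplified]
  have q: "(\<lambda>m. q (1 / a ^ m)) \<longlonglongrightarrow> l"
    by (rule filterlim_compose[OF lim z])
  have step: "q (1 / a ^ m) = r * q (1 / a ^ Suc m)" for m
    using scale[of "1 / a ^ Suc m"] a by simp
  have "(\<lambda>m. q (1 / a ^ m)) \<longlonglongrightarrow> r * l"
    using tendsto_mult_left[OF LIMSEQ_Suc[OF q], of r] by (simp only: step[symmetric])
  then have "r * l = l"
    using q by (rule LIMSEQ_unique)
  then show ?thesis
    using l by simp
qed

lemma even_power_scaling_gaussian:
  fixes f :: "real \<Rightarrow> real"
  assumes C2: "C2_at f 0" and f0: "f 0 = 1" and even: "\<And>t. f (- t) = f t"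
    and neg: "deriv (deriv f) 0 < 0"
    and a: "a > 1" and scale: "\<And>t. f (a * t) = f t ^ n"
  shows "a = sqrt (real n)" and "f t = exp (deriv (deriv f) 0 / 2 * t\<^sup>2)"
proof -
  define q where "q = (\<lambda>t. ln (f t) / t\<^sup>2)"
  define l where "l = deriv (deriv f) 0 / 2"
  have diff: "f differentiable (at 0)"
    using C2 eventually_nhds_x_imp_x by (auto simp: C2_at_def)
  have lim: "(q \<longlongrightarrow> l) (at 0)"
    unfolding q_def l_def
    by (rule tendsto_ln_over_square[OF C2 f0 deriv_even_at_zero[OF diff even]])
  have "(f \<longlongrightarrow> 1) (at 0)"
    using differentiable_imp_continuous_within[OF diff] f0 by (simp add: isCont_def)
  then have "\<forall>\<^sub>F t in at 0. f t > 0"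
    by (rule order_tendstoD(1)) simp
  then have pos: "f t > 0" if "t \<noteq> 0" for t
    using power_scaling_pos[where f = f and n = n, OF a scale _ that] by blast
  \<comment> \<open>Positivity of \<open>f t\<close> lets the exponent come out of the logarithm as
    the factor \<open>real n\<close>.\<close>
  have q_scale: "q (a * t) = (real n / a\<^sup>2) * q t" if "t \<noteq> 0" for t
    using pos[OF that] by (simp add: q_def scale ln_realpow power_mult_distrib)
  have r: "real n / a\<^sup>2 = 1"
    by (rule scaling_factor_eq_one[where q = q, OF a q_scale lim]) (use neg in \<open>simp_all add: l_def\<close>)
  then have "real n = a\<^sup>2"
    using a by (simp add: field_simps)
  then show "a = sqrt (real n)"
    using a by simp
  show "f t = exp (deriv (deriv f) 0 / 2 * t\<^sup>2)"
  \<comment> \<open>The origin is treated apart: \<open>q 0\<close> is a division by zero and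
    carries no information about \<open>f\<close>.\<close>
  proof (cases "t = 0")
    case False
    have "q t = l"
      by (rule scaling_invariant_eq_limit[where q = q, OF a _ lim False]) (simp add: q_scale r)
    then have "ln (f t) = l * t\<^sup>2"
      using False by (simp add: q_def field_simps)
    then show ?thesis
      using pos[OF False] by (metis exp_ln l_def)
  qed (simp add: f0)
qed

theorem proposition3p7:
  fixes K :: "real \<Rightarrow> real \<Rightarrow> real" and n0 :: nat and a :: real
  assumes "continuous_on UNIV (\<lambda>(x, y). K x y)"
    and "covariance_kernel K"
    and "stationary_kernel K"
    and "normalized_kernel K"
    and "C2_at (stationary_profile K) 0"
    and "deriv (deriv (stationary_profile K)) 0 < 0"
    and "n0 \<ge> 2"
    and "a > 1"
    and "\<And>x y. K (a * x) (a * y) = K x y ^ n0"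
  shows "a = sqrt (real n0) \<and>
    (let c = - (1 / 2) * deriv (deriv (stationary_profile K)) 0 in
       c > 0 \<and>
       (\<forall>x y. K x y = exp (- c * (x - y)\<^sup>2)) \<and>
       (\<exists>s>0. \<forall>x y. K (s * x) (s * y) = exp (- (x - y)\<^sup>2))) \<and>
    (- deriv (deriv (stationary_profile K)) 0 = 2 \<longrightarrow>
       (\<forall>x y. K x y = exp (- (x - y)\<^sup>2)))"
proof -
  define f where "f = stationary_profile K"
  define c where "c = - (1 / 2) * deriv (deriv f) 0"
  have K_eq: "K x y = f (x - y)" for x y
    using assms(3)[unfolded stationary_kernel_def, rule_format, of "x - y" y 0]
    by (simp add: f_def stationary_profile_def)
  have "K x y = K y x" for x y
    using assms(2) by (simp add: covariance_kernel_def)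
  \<comment> \<open>Symmetry of the kernel compares \<open>K 0 t = f (- t)\<close> with
    \<open>K t 0 = f t\<close>.\<close>
  then have even: "f (- t) = f t" for t
    by (metis K_eq diff_0 diff_zero)
  have f0: "f 0 = 1"
    using assms(4) K_eq[of 0 0] by (simp add: normalized_kernel_def)
  have scale: "f (a * t) = f t ^ n0" for t
    using assms(9)[of t 0] by (simp add: K_eq)
  note gaussian = even_power_scaling_gaussian[where f = f and n = n0 and a = a,
      OF assms(5)[folded f_def] f0 even assms(6)[folded f_def] assms(8) scale]
  have c: "c > 0"
    using assms(6) by (simp add: c_def f_def)
  have K_exp: "K x y = exp (- c * (x - y)\<^sup>2)" for x y
    using gaussian(2)[of "x - y"] by (simp add: K_eq c_def)
  \<comment> \<open>The factor \<open>s = 1 / sqrt c\<close> is the positive solution of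
    \<open>c * s^2 = 1\<close>.\<close>
  have "K (1 / sqrt c * x) (1 / sqrt c * y) = exp (- (x - y)\<^sup>2)" for x y
  proof -
    have "c * (1 / sqrt c * x - 1 / sqrt c * y)\<^sup>2 = (x - y)\<^sup>2"
      using c by (simp flip: diff_divide_distrib add: power_divide)
    then show ?thesis
      by (simp add: K_exp)
  qed
  then have "\<exists>s>0. \<forall>x y. K (s * x) (s * y) = exp (- (x - y)\<^sup>2)"
    using c by (intro exI[of _ "1 / sqrt c"]) auto
  moreover have "- deriv (deriv f) 0 = 2 \<longrightarrow> (\<forall>x y. K x y = exp (- (x - y)\<^sup>2))"
  proof (intro impI allI)
    fix x y
    assume "- deriv (deriv f) 0 = 2"
    then have "c = 1"
      by (simp add: c_def)
    then show "K x y = exp (- (x - y)\<^sup>2)"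
      by (simp add: K_exp)
  qed
  ultimately show ?thesis
    using gaussian(1) c K_exp unfolding Let_def f_def[symmetric] c_def[symmetric] by blast
qed

end
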